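(* Let $\Theta\ne\tilde\Theta$ be two distinct parameter trees, where $\Theta$ is the correct output of an update and $\tilde\Theta$ the output committed by the trainer, and let $\Delta=\tilde\Theta-\Theta$. Then the probability that the discrepancy $\Theta\neq\tilde\Theta$ survives unnoticed satisfies $$\Pr[\text{undetected}]\le 1-p_{\mathrm{check}}\left(\frac{G(\Delta)}{|\Theta|}\right)+\operatorname{negl}(\lambda),$$ where $$G(\Delta)=\min\left(|\Theta|,\ \sum_j\sum_r \mathbf 1_{\Delta^{(j)}_r\ne 0}\,(l_j+1)\right).$$
   Context: A parameter tree consists of matrix leaves $\Theta^{(1)},\dots,\Theta^{(m)}$, leaf $j$ having rows in $\mathbb R^{d_j}$; $|\Theta|$ is the total number of scalar entries, and $\Delta^{(j)}_r$ is the $r$-th row of the $j$-th leaf of $\Delta$. For a sketch fraction $p_{\mathrm{sketch}}\in(0,1]$, $l_j=\min\{\max\{\lceil p_{\mathrm{sketch}}d_j\rceil,1\},d_j\}$, and $Q_j\in\mathbb R^{d_j\times l_j}$ is a fixed matrix with orthonormal columns obtained by orthonormalizing a Gaussian matrix, so that (almost surely) any $l_j$ rows of $Q_j$ are linearly independent. The sketch commitment of the parameters at step $i$ is $C_\theta(\Theta)=C^{(m)}$, where $C^{(0)}=\bot$ and $C^{(j)}=\mathcal H_{\mathrm{sketch}}\left(\mathcal H_{\mathrm{sketch}}(i,j,\operatorname{vec}(\Theta^{(j)}Q_j)),\,C^{(j-1)}\right)$ (exact real arithmetic). Challenge: after $\tilde\Theta$ is fixed, the update is challenged with probability $p_{\mathrm{check}}$.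 If challenged, the correct $\Theta$ is recomputed, $C_\theta(\Theta)$ is compared with $C_\theta(\tilde\Theta)$, and one scalar parameter position, sampled uniformly from the $|\Theta|$ positions and independently, is compared exactly between $\Theta$ and $\tilde\Theta$. The discrepancy is undetected if the update is not challenged, or it is challenged and both comparisons agree. The adversary choosing $\tilde\Theta$ is probabilistic polynomial-time in the security parameter $\lambda$, knows the $Q_j$, and finds collisions in $\mathcal H_{\mathrm{sketch}}$ with probability at most $\operatorname{negl}(\lambda)$, a negligible function. *)

theory Defs
  imports
    "HOL-Probability.Probability_Mass_Function"
    "Jordan_Normal_Form.VS_Connect"
begin

hide_const (open) Finite_Cartesian_Product.vec Finite_Cartesian_Product.row
hide_type (open) Finite_Cartesian_Product.vec

section \<open>Parameter trees\<close>

text \<open>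
  The tree with leaves \<open>\<Theta>\<^sub>1, \<dots>, \<Theta>\<^sub>m\<close> is the list of its leaves, so the paper's leaf \<open>j\<close>
  is \<open>\<Theta> ! (j - 1)\<close>. Leaf, row and column positions below count from 0.
\<close>

type_synonym param_tree = "real mat list"

definition shape :: "param_tree \<Rightarrow> (nat \<times> nat) list" where
  "shape \<Theta> = map (\<lambda>A. (dim_row A, dim_col A)) \<Theta>"

definition positions :: "param_tree \<Rightarrow> (nat \<times> nat \<times> nat) set" where
  "positions \<Theta> = {(j, r, c). j < length \<Theta> \<and> r < dim_row (\<Theta> ! j) \<and> c < dim_col (\<Theta> ! j)}"

fun entry :: "param_tree \<Rightarrow> nat \<times> nat \<times> nat \<Rightarrow> real" where
  "entry \<Theta> (j, r, c) = (\<Theta> ! j) $$ (r, c)"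

definition num_params :: "param_tree \<Rightarrow> nat" where
  "num_params \<Theta> = (\<Sum>A\<leftarrow>\<Theta>. dim_row A * dim_col A)"

definition tree_diff :: "param_tree \<Rightarrow> param_tree \<Rightarrow> param_tree" where
  "tree_diff \<Theta>' \<Theta> = map2 (-) \<Theta>' \<Theta>"

section \<open>Sketching matrices\<close>

definition sketch_dim :: "real \<Rightarrow> nat \<Rightarrow> nat" where
  "sketch_dim p d = min (max (nat \<lceil>p * real d\<rceil>) 1) d"

definition orthonormal_cols :: "real mat \<Rightarrow> bool" where
  "orthonormal_cols Q \<longleftrightarrow>
     (\<forall>a < dim_col Q. \<forall>b < dim_col Q. scalar_prod (col Q a) (col Q b) = (if a = b then 1 else 0))"

text \<open>
  \<open>lin_dep\<close> speaks about sets of vectors, so linear independence of the family of rows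
  with indices in \<open>I\<close> also requires these rows to be pairwise distinct.
\<close>

definition lin_indep_rows :: "real mat \<Rightarrow> nat set \<Rightarrow> bool" where
  "lin_indep_rows Q I \<longleftrightarrow>
     inj_on (row Q) I \<and>
     \<not> module.lin_dep class_ring (module_vec TYPE(real) (dim_col Q)) (row Q ` I)"

text \<open>
  A realisation of an orthonormalised Gaussian matrix, outside the null event on which some
  \<open>l\<close> of its rows are linearly dependent.
\<close>

definition sketch_matrix :: "real \<Rightarrow> nat \<Rightarrow> real mat \<Rightarrow> bool" where
  "sketch_matrix p d Q \<longleftrightarrow>
     Q \<in> carrier_mat d (sketch_dim p d) \<and>
     orthonormal_cols Q \<and>
     (\<forall>I. I \<subseteq> {..<d} \<and> card I = sketch_dim p d \<longrightarrow> lin_indep_rows Q I)"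

definition sketch_matrices :: "real \<Rightarrow> param_tree \<Rightarrow> real mat list \<Rightarrow> bool" where
  "sketch_matrices p \<Theta> Q \<longleftrightarrow> list_all2 (\<lambda>A. sketch_matrix p (dim_col A)) \<Theta> Q"

section \<open>Sketch commitment\<close>

text \<open>
  The two kinds of messages hashed by \<open>H\<close>: triples \<open>(i, j, vec (\<Theta>\<^sub>j Q\<^sub>j))\<close> and pairs \<open>(h, C)\<close>,
  where \<open>None\<close> is the initial commitment \<open>\<bottom>\<close>.
\<close>

datatype 'h message = Leaf nat nat "real vec" | Chain 'h "'h option"

text \<open>Column stacking.\<close>

definition vectorize :: "real mat \<Rightarrow> real vec" where
  "vectorize A = Matrix.vec (dim_row A * dim_col A)
     (\<lambda>k. A $$ (k mod dim_row A, k div dim_row A))"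

definition leaf_message :: "nat \<Rightarrow> real mat list \<Rightarrow> param_tree \<Rightarrow> nat \<Rightarrow> 'h message" where
  "leaf_message i Q \<Theta> j = Leaf i j (vectorize (\<Theta> ! (j - 1) * Q ! (j - 1)))"

fun partial_commit ::
  "('h message \<Rightarrow> 'h) \<Rightarrow> nat \<Rightarrow> real mat list \<Rightarrow> param_tree \<Rightarrow> nat \<Rightarrow> 'h option" where
  "partial_commit H i Q \<Theta> 0 = None"
| "partial_commit H i Q \<Theta> (Suc j) =
     Some (H (Chain (H (leaf_message i Q \<Theta> (Suc j))) (partial_commit H i Q \<Theta> j)))"

definition commit ::
  "('h message \<Rightarrow> 'h) \<Rightarrow> nat \<Rightarrow> real mat list \<Rightarrow> param_tree \<Rightarrow> 'h option" where
  "commit H i Q \<Theta> = partial_commit H i Q \<Theta> (length \<Theta>)"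

text \<open>All messages hashed while computing \<open>commit H i Q \<Theta>\<close>.\<close>

definition hashed_messages ::
  "('h message \<Rightarrow> 'h) \<Rightarrow> nat \<Rightarrow> real mat list \<Rightarrow> param_tree \<Rightarrow> 'h message set" where
  "hashed_messages H i Q \<Theta> =
     (\<Union>j < length \<Theta>. {leaf_message i Q \<Theta> (Suc j),
        Chain (H (leaf_message i Q \<Theta> (Suc j))) (partial_commit H i Q \<Theta> j)})"

definition exhibits_collision ::
  "('h message \<Rightarrow> 'h) \<Rightarrow> nat \<Rightarrow> real mat list \<Rightarrow> param_tree \<Rightarrow> param_tree \<Rightarrow> bool" where
  "exhibits_collision H i Q \<Theta> \<Theta>' \<longleftrightarrow>
     (\<exists>x \<in> hashed_messages H i Q \<Theta>. \<exists>y \<in> hashed_messages H i Q \<Theta>'. x \<noteq> y \<and> H x = H y)"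

section \<open>The challenge experiment\<close>

text \<open>
  \<open>keys\<close> draws the public description \<open>k\<close> of the hash function \<open>H k\<close>; a fixed hash function
  is the case of a one-point distribution. The adversary \<open>\<A>\<close> gets \<open>k\<close> and the sketching matrices
  and returns the distribution of its output. The challenge is drawn after that output is fixed.
\<close>

type_synonym 'k adversary = "'k \<Rightarrow> real mat list \<Rightarrow> param_tree pmf"

definition committed ::
  "'k pmf \<Rightarrow> 'k adversary \<Rightarrow> real mat list \<Rightarrow> param_tree pmf" where
  "committed keys \<A> Q = do { k \<leftarrow> keys; \<A> k Q }"

definition undetected ::
  "('k \<Rightarrow> 'h message \<Rightarrow> 'h) \<Rightarrow> 'k pmf \<Rightarrow> 'k adversary \<Rightarrow> real \<Rightarrow> nat \<Rightarrow>
   real mat list \<Rightarrow> param_tree \<Rightarrow> bool pmf" where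
  "undetected H keys \<A> p_check i Q \<Theta> = do {
     k \<leftarrow> keys;
     \<Theta>' \<leftarrow> \<A> k Q;
     challenged \<leftarrow> bernoulli_pmf p_check;
     if challenged then do {
       x \<leftarrow> pmf_of_set (positions \<Theta>);
       return_pmf (commit (H k) i Q \<Theta> = commit (H k) i Q \<Theta>' \<and> entry \<Theta> x = entry \<Theta>' x)
     } else return_pmf True
   }"

definition finds_collision ::
  "('k \<Rightarrow> 'h message \<Rightarrow> 'h) \<Rightarrow> 'k pmf \<Rightarrow> 'k adversary \<Rightarrow> nat \<Rightarrow>
   real mat list \<Rightarrow> param_tree \<Rightarrow> bool pmf" where
  "finds_collision H keys \<A> i Q \<Theta> = do {
     k \<leftarrow> keys;
     \<Theta>' \<leftarrow> \<A> k Q;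
     return_pmf (exhibits_collision (H k) i Q \<Theta> \<Theta>')
   }"

definition negligible_fun :: "(nat \<Rightarrow> real) \<Rightarrow> bool" where
  "negligible_fun f \<longleftrightarrow> (\<forall>c::nat. \<forall>\<^sub>F n in sequentially. \<bar>f n\<bar> < 1 / real n ^ c)"

section \<open>The detection count\<close>

definition G :: "real \<Rightarrow> param_tree \<Rightarrow> param_tree \<Rightarrow> nat" where
  "G p \<Theta> \<Delta> = min (num_params \<Theta>)
     (\<Sum>j < length \<Delta>. \<Sum>r < dim_row (\<Delta> ! j).
        if row (\<Delta> ! j) r \<noteq> 0\<^sub>v (dim_col (\<Delta> ! j)) then sketch_dim p (dim_col (\<Delta> ! j)) + 1 else 0)"

end

(*
If the sketches of a leaf and of its tampered version agree, every row v of the difference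
satisfies v Q = 0, a linear relation between the rows of Q. As any l rows of Q are linearly
independent, a nonzero v has at least l + 1 nonzero entries. So, unless a collision of the hash
function is exhibited, equal commitments force at least G differing scalar positions, and a
uniform position misses all of them with probability at most 1 - G / n, where n is the number of
positions. Averaging over key and adversary output adds the collision probability.
*)
theory Submission
  imports Defs
begin

unbundle no vec_syntax

section \<open>Linear relations between the rows of a sketching matrix\<close>

text \<open>Bridge from \<open>lin_dep\<close>, which concerns sets of vectors, to relations with
  coefficients indexed by row numbers, the form in which a product with \<open>Q\<close> produces
  them.\<close>

lemma lin_indep_rows_lincomb_zero:
  assumes "lin_indep_rows Q I" "I \<subseteq> {..<dim_row Q}"
    and rel: "\<And>c. c < dim_col Q \<Longrightarrow> (\<Sum>k\<in>I. f k * Q $$ (k, c)) = 0"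
    and "k \<in> I"
  shows "f k = 0"
proof (rule ccontr)
  assume nz: "f k \<noteq> 0"
  interpret vec_space "TYPE(real)" "dim_col Q" .
  have inj: "inj_on (row Q) I" and indep: "\<not> lin_dep (row Q ` I)"
    using assms(1) by (auto simp: lin_indep_rows_def)
  have fin: "finite (row Q ` I)"
    using assms(2) finite_subset by blast
  have carrier: "row Q ` I \<subseteq> carrier_vec (dim_col Q)"
    by auto
  \<comment> \<open>\<open>lincomb\<close> attaches coefficients to vectors; as \<open>row Q\<close>
    is injective on \<open>I\<close>, the index of a row can be recovered from the row
    itself.\<close>
  define a where "a = f \<circ> the_inv_into I (row Q)"
  have "lincomb a (row Q ` I) = 0\<^sub>v (dim_col Q)"
  proof (rule eq_vecI)
    fix c assume "c < dim_vec (0\<^sub>v (dim_col Q) :: real Matrix.vec)"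
    then have c: "c < dim_col Q" by simp
    have "lincomb a (row Q ` I) $ c = (\<Sum>x\<in>row Q ` I. a x * x $ c)"
      by (rule lincomb_index[OF c carrier])
    also have "\<dots> = (\<Sum>j\<in>I. f j * Q $$ (j, c))"
      using c assms(2)
      by (subst sum.reindex[OF inj]) (auto simp: a_def the_inv_into_f_f[OF inj] intro!: sum.cong)
    also have "\<dots> = 0"
      by (rule rel[OF c])
    finally show "lincomb a (row Q ` I) $ c = 0\<^sub>v (dim_col Q) $ c"
      using c by simp
  qed (use lincomb_dim[OF fin carrier] in simp)
  moreover have "a (row Q k) \<noteq> 0"
    using nz \<open>k \<in> I\<close> by (simp add: a_def the_inv_into_f_f[OF inj])
  ultimately have "lin_dep (row Q ` I)"
    unfolding lin_dep_def using fin \<open>k \<in> I\<close> by fastforce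
  then show False using indep by simp
qed

text \<open>A support of at most l elements could be padded to exactly l row indices. The relation
  restricted to them still holds, since \<open>v\<close> vanishes off its support, and independence
  would force \<open>v\<close> to be zero. For l = d no nonzero \<open>v\<close> satisfies the
  hypotheses.\<close>

lemma sketch_kernel_support:
  assumes Q: "sketch_matrix p d Q" and v: "v \<in> carrier_vec d" "v \<noteq> 0\<^sub>v d"
    and ker: "\<And>c. c < dim_col Q \<Longrightarrow> (\<Sum>k<d. v $ k * Q $$ (k, c)) = 0"
  shows "sketch_dim p d + 1 \<le> card {k. k < d \<and> v $ k \<noteq> 0}"
proof (rule ccontr)
  define S where "S = {k. k < d \<and> v $ k \<noteq> 0}"
  assume "\<not> ?thesis"
  then have small: "card S \<le> sketch_dim p d"
    by (simp add: S_def)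
  have "S \<subseteq> {..<d}" and fin: "finite S"
    by (auto simp: S_def)
  \<comment> \<open>The outer minimum in \<open>sketch_dim\<close> guarantees that d indices leave
    room for the padding.\<close>
  moreover have "sketch_dim p d \<le> card {..<d}"
    by (simp add: sketch_dim_def)
  ultimately obtain I where I: "S \<subseteq> I" "I \<subseteq> {..<d}" "card I = sketch_dim p d"
    using small by (metis exists_subset_between finite_lessThan)
  have indep: "lin_indep_rows Q I" and dim: "dim_row Q = d"
    using Q I by (auto simp: sketch_matrix_def)
  have "(\<Sum>k\<in>I. v $ k * Q $$ (k, c)) = 0" if "c < dim_col Q" for c
  proof -
    have "(\<Sum>k\<in>I. v $ k * Q $$ (k, c)) = (\<Sum>k<d. v $ k * Q $$ (k, c))"
      by (rule sum.mono_neutral_left) (use I in \<open>auto simp: S_def\<close>)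
    then show ?thesis using ker[OF that] by simp
  qed
  then have "v $ k = 0" if "k \<in> I" for k
    using lin_indep_rows_lincomb_zero[OF indep, of "\<lambda>k. v $ k"] I dim that by blast
  then have "v $ k = 0" if "k < d" for k
    using that I by (auto simp: S_def)
  then have "v = 0\<^sub>v d"
    using v(1) by (intro eq_vecI) auto
  then show False using v(2) by simp
qed

section \<open>Binding of the commitment chain\<close>

lemma vectorize_inject:
  assumes "dim_row A = dim_row B" "dim_col A = dim_col B" and eq: "vectorize A = vectorize B"
  shows "A = B"
proof (rule eq_matI)
  fix r c assume r: "r < dim_row B" and c: "c < dim_col B"
  \<comment> \<open>The place of entry (r, c) in the column-stacked vector.\<close>
  let ?k = "c * dim_row B + r"
  have "?k < Suc c * dim_row B"
    using r by simp
  also have "\<dots> \<le> dim_row B * dim_col B"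
    using c by (metis Suc_leI mult.commute mult_le_mono2)
  finally have "?k < dim_row B * dim_col B" .
  moreover have "?k mod dim_row B = r" "?k div dim_row B = c"
    using r by auto
  ultimately show "A $$ (r, c) = B $$ (r, c)"
    using arg_cong[OF eq, of "\<lambda>w. w $ ?k"] assms(1,2) by (simp add: vectorize_def)
qed (use assms in auto)

text \<open>The chain is unwound from its last link: without a collision, equal hashes come from
  equal \<open>Chain\<close> messages, which yields equal leaf hashes and equal shorter chains.
  Equal leaf hashes in turn come from equal leaf messages. Equal lengths ensure that both
  computations hash the links compared.\<close>

lemma leaf_message_eq_if_partial_commit_eq:
  fixes H :: "'h message \<Rightarrow> 'h"
  assumes no_coll: "\<not> exhibits_collision H i Q \<Theta> \<Theta>'" and len: "length \<Theta>' = length \<Theta>"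
    and "n \<le> length \<Theta>" "partial_commit H i Q \<Theta> n = partial_commit H i Q \<Theta>' n" "j < n"
  shows "leaf_message i Q \<Theta> (Suc j) = (leaf_message i Q \<Theta>' (Suc j) :: 'h message)"
  using assms(3-5)
proof (induction n)
  case (Suc n)
  have inj: "x = y" if "x \<in> hashed_messages H i Q \<Theta>" "y \<in> hashed_messages H i Q \<Theta>'" "H x = H y" for x y
    using no_coll that by (auto simp: exhibits_collision_def)
  let ?m = "leaf_message i Q \<Theta> (Suc n) :: 'h message" and ?m' = "leaf_message i Q \<Theta>' (Suc n)"
  have mem: "?m \<in> hashed_messages H i Q \<Theta>" "?m' \<in> hashed_messages H i Q \<Theta>'"
    "Chain (H ?m) (partial_commit H i Q \<Theta> n) \<in> hashed_messages H i Q \<Theta>"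
    "Chain (H ?m') (partial_commit H i Q \<Theta>' n) \<in> hashed_messages H i Q \<Theta>'"
    using Suc.prems(1) len by (auto simp: hashed_messages_def)
  have "Chain (H ?m) (partial_commit H i Q \<Theta> n) = Chain (H ?m') (partial_commit H i Q \<Theta>' n)"
    using Suc.prems(2) by (intro inj mem) simp
  then have "H ?m = H ?m'" "partial_commit H i Q \<Theta> n = partial_commit H i Q \<Theta>' n"
    by auto
  then show ?case
    using Suc inj[OF mem(1,2)] by (cases "j = n") auto
qed simp

section \<open>Scalar positions and differing entries\<close>

lemma shape_nth:
  assumes "shape \<Theta>' = shape \<Theta>" "j < length \<Theta>"
  shows "dim_row (\<Theta>' ! j) = dim_row (\<Theta> ! j)" "dim_col (\<Theta>' ! j) = dim_col (\<Theta> ! j)"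
proof -
  have "length \<Theta>' = length \<Theta>"
    using arg_cong[OF assms(1), of length] by (simp add: shape_def)
  then show "dim_row (\<Theta>' ! j) = dim_row (\<Theta> ! j)" "dim_col (\<Theta>' ! j) = dim_col (\<Theta> ! j)"
    using arg_cong[OF assms(1), of "\<lambda>xs. xs ! j"] assms(2) by (simp_all add: shape_def)
qed

lemma shape_length: "shape \<Theta>' = shape \<Theta> \<Longrightarrow> length \<Theta>' = length \<Theta>"
  by (metis length_map shape_def)

lemma positions_Sigma:
  "positions \<Theta> = (SIGMA j:{..<length \<Theta>}. {..<dim_row (\<Theta> ! j)} \<times> {..<dim_col (\<Theta> ! j)})"
  by (auto simp: positions_def)

lemma finite_positions: "finite (positions \<Theta>)"
  by (simp add: positions_Sigma)

lemma card_positions: "card (positions \<Theta>) = num_params \<Theta>"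
  by (simp add: positions_Sigma num_params_def sum_list_sum_nth atLeast0LessThan)

text \<open>Distinct trees of one shape must differ at some scalar position. This makes
  \<open>pmf_of_set\<close> a genuine uniform distribution and the number of parameters a positive
  denominator.\<close>

lemma positions_nonempty:
  assumes "shape \<Theta>' = shape \<Theta>" "\<Theta> \<noteq> \<Theta>'"
  shows "positions \<Theta> \<noteq> {}"
proof
  assume empty: "positions \<Theta> = {}"
  have "\<Theta> ! j = \<Theta>' ! j" if "j < length \<Theta>" for j
    by (rule eq_matI) (use empty that shape_nth[OF assms(1) that] in \<open>auto simp: positions_def\<close>)
  then show False
    using assms shape_length[OF assms(1)] by (auto simp: list_eq_iff_nth_eq)
qed

lemma card_differing_positions_ge_G:
  fixes H :: "'h message \<Rightarrow> 'h"
  assumes Q: "sketch_matrices p \<Theta> Q" and shape: "shape \<Theta>' = shape \<Theta>"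
    and com: "commit H i Q \<Theta> = commit H i Q \<Theta>'"
    and no_coll: "\<not> exhibits_collision H i Q \<Theta> \<Theta>'"
  shows "G p \<Theta> (tree_diff \<Theta>' \<Theta>) \<le> card {x \<in> positions \<Theta>. entry \<Theta> x \<noteq> entry \<Theta>' x}"
proof -
  define \<Delta> where "\<Delta> = tree_diff \<Theta>' \<Theta>"
  note len = shape_length[OF shape]
  have len\<Delta>: "length \<Delta> = length \<Theta>"
    using len by (simp add: \<Delta>_def tree_diff_def)
  have \<Delta>: "\<Delta> ! j = \<Theta>' ! j - \<Theta> ! j" "dim_row (\<Delta> ! j) = dim_row (\<Theta> ! j)"
    "dim_col (\<Delta> ! j) = dim_col (\<Theta> ! j)" if "j < length \<Theta>" for j
    using that len by (simp_all add: \<Delta>_def tree_diff_def)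
  \<comment> \<open>The fibre over (j, r) of the set of differing positions; these fibres turn the
    sum of row weights into the cardinality of a single set.\<close>
  define D where "D j r = {c. c < dim_col (\<Theta> ! j) \<and> row (\<Delta> ! j) r $ c \<noteq> 0}" for j r
  have row_weight: "sketch_dim p (dim_col (\<Theta> ! j)) + 1 \<le> card (D j r)"
    if j: "j < length \<Theta>" and r: "r < dim_row (\<Theta> ! j)"
      and nz: "row (\<Delta> ! j) r \<noteq> 0\<^sub>v (dim_col (\<Theta> ! j))" for j r
  proof -
    let ?d = "dim_col (\<Theta> ! j)" and ?Q = "Q ! j"
    have S: "sketch_matrix p ?d ?Q"
      using Q j by (auto simp: sketch_matrices_def list_all2_conv_all_nth)
    then have dimQ: "dim_row ?Q = ?d"
      by (auto simp: sketch_matrix_def)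
    \<comment> \<open>The chain result is applied at full length. Messages number leaves from 1,
      hence the \<open>Suc j\<close> for list index j.\<close>
    have "leaf_message i Q \<Theta> (Suc j) = (leaf_message i Q \<Theta>' (Suc j) :: 'h message)"
      using leaf_message_eq_if_partial_commit_eq[OF no_coll len order_refl] com len j
      by (simp add: commit_def)
    then have sketch: "\<Theta> ! j * ?Q = \<Theta>' ! j * ?Q"
      by (intro vectorize_inject) (simp_all add: leaf_message_def shape_nth[OF shape j])
    have ker: "(\<Sum>k<?d. row (\<Delta> ! j) r $ k * ?Q $$ (k, c)) = 0" if c: "c < dim_col ?Q" for c
    proof -
      have prod: "(\<Sum>k<?d. A $$ (r, k) * ?Q $$ (k, c)) = (A * ?Q) $$ (r, c)"
        if "dim_row A = dim_row (\<Theta> ! j)" "dim_col A = ?d" for A :: "real mat"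
        using that r c dimQ by (auto simp: scalar_prod_def atLeast0LessThan intro!: sum.cong)
      have "(\<Sum>k<?d. row (\<Delta> ! j) r $ k * ?Q $$ (k, c)) =
          (\<Sum>k<?d. (\<Theta>' ! j) $$ (r, k) * ?Q $$ (k, c)) - (\<Sum>k<?d. (\<Theta> ! j) $$ (r, k) * ?Q $$ (k, c))"
        using r by (auto simp: \<Delta>[OF j] left_diff_distrib sum_subtractf[symmetric] intro!: sum.cong)
      then show ?thesis
        using prod shape_nth[OF shape j] sketch by simp
    qed
    have "row (\<Delta> ! j) r \<in> carrier_vec ?d"
      using row_carrier[of "\<Delta> ! j" r] by (simp only: \<Delta>(3)[OF j])
    from sketch_kernel_support[OF S this nz ker] show ?thesis
      by (simp add: D_def)
  qed
  have "G p \<Theta> \<Delta> \<le> (\<Sum>j < length \<Delta>. \<Sum>r < dim_row (\<Delta> ! j).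
      if row (\<Delta> ! j) r \<noteq> 0\<^sub>v (dim_col (\<Delta> ! j)) then sketch_dim p (dim_col (\<Delta> ! j)) + 1 else 0)"
    by (simp add: G_def)
  also have "\<dots> \<le> (\<Sum>j<length \<Theta>. \<Sum>r<dim_row (\<Theta> ! j). card (D j r))"
    unfolding len\<Delta>
  proof (intro sum_mono, goal_cases)
    case (1 j)
    then have j: "j < length \<Theta>" by simp
    show ?case
      unfolding \<Delta>(2,3)[OF j] using row_weight[OF j] by (intro sum_mono) auto
  qed
  also have "\<dots> = card (SIGMA j:{..<length \<Theta>}. SIGMA r:{..<dim_row (\<Theta> ! j)}. D j r)"
    by (simp add: D_def)
  also have "(SIGMA j:{..<length \<Theta>}. SIGMA r:{..<dim_row (\<Theta> ! j)}. D j r) =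
      {x \<in> positions \<Theta>. entry \<Theta> x \<noteq> entry \<Theta>' x}"
    by (auto simp: positions_def D_def \<Delta>)
  finally show ?thesis
    by (simp add: \<Delta>_def)
qed

section \<open>Survival probability for a fixed key and output\<close>

text \<open>The tail of \<open>undetected\<close> after key and output are drawn, split off so that
  it can be bounded pointwise before averaging.\<close>

definition challenge ::
  "('h message \<Rightarrow> 'h) \<Rightarrow> real \<Rightarrow> nat \<Rightarrow> real mat list \<Rightarrow> param_tree \<Rightarrow> param_tree \<Rightarrow> bool pmf" where
  "challenge H p_check i Q \<Theta> \<Theta>' = do {
     challenged \<leftarrow> bernoulli_pmf p_check;
     if challenged then do {
       x \<leftarrow> pmf_of_set (positions \<Theta>);
       return_pmf (commit H i Q \<Theta> = commit H i Q \<Theta>' \<and> entry \<Theta> x = entry \<Theta>' x)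
     } else return_pmf True
   }"

text \<open>The indicator pays for outputs that exhibit a collision, where nothing is known about
  the number of differing entries. All other outputs fail the sketch comparison or differ in at
  least \<open>G\<close> positions.\<close>

lemma pmf_challenge_le:
  assumes p: "0 \<le> p_check" "p_check \<le> 1" and Q: "sketch_matrices p \<Theta> Q"
    and shape: "shape \<Theta>' = shape \<Theta>" and neq: "\<Theta> \<noteq> \<Theta>'"
  shows "pmf (challenge H p_check i Q \<Theta> \<Theta>') True \<le>
    1 - p_check * (real (G p \<Theta> (tree_diff \<Theta>' \<Theta>)) / real (num_params \<Theta>))
      + of_bool (exhibits_collision H i Q \<Theta> \<Theta>')"
proof -
  define n where "n = num_params \<Theta>"
  define g where "g = G p \<Theta> (tree_diff \<Theta>' \<Theta>)"
  define q where "q = pmf (do {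
       x \<leftarrow> pmf_of_set (positions \<Theta>);
       return_pmf (commit H i Q \<Theta> = commit H i Q \<Theta>' \<and> entry \<Theta> x = entry \<Theta>' x) }) True"
  have ne: "positions \<Theta> \<noteq> {}"
    by (rule positions_nonempty[OF shape neq])
  have n: "n = card (positions \<Theta>)" "n > 0"
    using ne finite_positions by (auto simp: n_def card_positions[symmetric] card_gt_0_iff)
  have "g \<le> n"
    by (simp add: g_def n_def G_def)
  \<comment> \<open>This is where the cap in \<open>G\<close> matters: the bound on \<open>q\<close>
    must be at least 1 under a collision and nonnegative when the commitments differ.\<close>
  then have ratio: "real g / real n \<le> 1"
    using n by simp
  have "pmf (challenge H p_check i Q \<Theta> \<Theta>') True = p_check * q + (1 - p_check)"
    unfolding challenge_def using p by (simp add: pmf_bind[of "bernoulli_pmf p_check"] q_def)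
  moreover have "p_check * q \<le> p_check * (1 - real g / real n + of_bool (exhibits_collision H i Q \<Theta> \<Theta>'))"
  proof (intro mult_left_mono p)
    consider "exhibits_collision H i Q \<Theta> \<Theta>'" | "commit H i Q \<Theta> \<noteq> commit H i Q \<Theta>'"
      | "\<not> exhibits_collision H i Q \<Theta> \<Theta>'" "commit H i Q \<Theta> = commit H i Q \<Theta>'"
      by blast
    then show "q \<le> 1 - real g / real n + of_bool (exhibits_collision H i Q \<Theta> \<Theta>')"
    proof cases
      case 1
      have "q \<le> 1"
        unfolding q_def by (rule pmf_le_1)
      then show ?thesis using 1 ratio by simp
    next
      case 2
      then show ?thesis using ratio by (simp add: q_def pmf_return)
    next
      case 3
      let ?D = "{x \<in> positions \<Theta>. entry \<Theta> x \<noteq> entry \<Theta>' x}"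
      have "q = card {x \<in> positions \<Theta>. entry \<Theta> x = entry \<Theta>' x} / n"
        using 3(2) ne finite_positions
        by (simp add: q_def n pmf_bind_pmf_of_set indicator_def sum.If_cases Int_def)
      also have "{x \<in> positions \<Theta>. entry \<Theta> x = entry \<Theta>' x} = positions \<Theta> - ?D"
        by auto
      also have "real (card (positions \<Theta> - ?D)) = real n - real (card ?D)"
        using finite_positions by (simp add: n card_Diff_subset of_nat_diff card_mono)
      also have "\<dots> \<le> real n - real g"
        using card_differing_positions_ge_G[OF Q shape 3(2,1)] by (simp add: g_def)
      finally show ?thesis
        using n 3(1) by (simp add: diff_divide_distrib divide_right_mono)
    qed
  qed
  \<comment> \<open>Collisions help only in the challenged branch; the factor \<open>p_check\<close>
    on their term is given away.\<close>
  moreover have "p_check * of_bool (exhibits_collision H i Q \<Theta> \<Theta>') \<le> of_bool (exhibits_collision H i Q \<Theta> \<Theta>')"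
    using p by simp
  ultimately show ?thesis
    unfolding g_def n_def by (simp add: algebra_simps)
qed

section \<open>Averaging over key and output\<close>

text \<open>The pointwise bound is affine in \<open>G\<close> and in the collision indicator, so
  integration replaces them by the mean of \<open>G\<close> and by the collision
  probability.\<close>

lemma pmf_undetected_le:
  assumes p: "0 \<le> p_check" "p_check \<le> 1" and Q: "sketch_matrices p \<Theta> Q"
    and supp: "\<And>\<Theta>'. \<Theta>' \<in> set_pmf (committed keys \<A> Q) \<Longrightarrow> shape \<Theta>' = shape \<Theta> \<and> \<Theta> \<noteq> \<Theta>'"
  shows "pmf (undetected H keys \<A> p_check i Q \<Theta>) True \<le>
    1 - p_check * (measure_pmf.expectation (committed keys \<A> Q)
          (\<lambda>\<Theta>'. real (G p \<Theta> (tree_diff \<Theta>' \<Theta>))) / real (num_params \<Theta>))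
      + pmf (finds_collision H keys \<A> i Q \<Theta>) True"
proof -
  \<comment> \<open>The commitment depends on the key, so the averages are taken over the joint distribution
    of the key and the adversary's output.\<close>
  define M where "M = keys \<bind> (\<lambda>k. map_pmf (Pair k) (\<A> k Q))"
  define n where "n = real (num_params \<Theta>)"
  define coll where "coll = (\<lambda>(k, \<Theta>'). exhibits_collision (H k) i Q \<Theta> \<Theta>')"
  have committed: "committed keys \<A> Q = map_pmf snd M"
    by (simp add: M_def committed_def map_bind_pmf pmf.map_comp o_def)
  have undetected: "undetected H keys \<A> p_check i Q \<Theta> = M \<bind> (\<lambda>(k, \<Theta>'). challenge (H k) p_check i Q \<Theta> \<Theta>')"
    by (simp add: M_def undetected_def challenge_def bind_assoc_pmf bind_map_pmf)
  have collision: "finds_collision H keys \<A> i Q \<Theta> = M \<bind> (\<lambda>x. return_pmf (coll x))"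
    by (simp add: M_def finds_collision_def coll_def bind_assoc_pmf bind_map_pmf)
  \<comment> \<open>Supports may be infinite, so integrability is derived from boundedness; for
    \<open>G\<close> the cap supplies the bound.\<close>
  have int: "integrable (measure_pmf M) f" if "\<And>x. \<bar>f x\<bar> \<le> B" for f :: "'a \<times> param_tree \<Rightarrow> real" and B
    using that by (intro measure_pmf.integrable_const_bound[where B = B]) auto
  have int_coll: "integrable (measure_pmf M) (\<lambda>x. of_bool (coll x) :: real)"
    by (rule int[of _ 1]) auto
  have int_g: "integrable (measure_pmf M) (\<lambda>(k, \<Theta>'). real (G p \<Theta> (tree_diff \<Theta>' \<Theta>)))"
    by (rule int[of _ n]) (auto simp: n_def G_def)
  have "pmf (undetected H keys \<A> p_check i Q \<Theta>) True =
      (\<integral>x. pmf (case x of (k, \<Theta>') \<Rightarrow> challenge (H k) p_check i Q \<Theta> \<Theta>') True \<partial>measure_pmf M)"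
    by (simp add: undetected pmf_bind)
  also have "\<dots> \<le> (\<integral>x. 1 - p_check * ((case x of (k, \<Theta>') \<Rightarrow> real (G p \<Theta> (tree_diff \<Theta>' \<Theta>))) / n)
      + of_bool (coll x) \<partial>measure_pmf M)"
  \<comment> \<open>The comparison is made only on the support, where \<open>supp\<close> provides
    equal shape and distinctness.\<close>
  proof (intro integral_mono_AE AE_pmfI)
    fix x assume "x \<in> set_pmf M"
    then have "snd x \<in> set_pmf (committed keys \<A> Q)"
      by (simp add: committed)
    then show "pmf (case x of (k, \<Theta>') \<Rightarrow> challenge (H k) p_check i Q \<Theta> \<Theta>') True \<le>
        1 - p_check * ((case x of (k, \<Theta>') \<Rightarrow> real (G p \<Theta> (tree_diff \<Theta>' \<Theta>))) / n) + of_bool (coll x)"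
      using pmf_challenge_le[OF p Q, where H = "H (fst x)" and i = i and \<Theta>' = "snd x"] supp
      by (auto simp: n_def coll_def split: prod.split)
  next
    show "integrable (measure_pmf M) (\<lambda>x. pmf (case x of (k, \<Theta>') \<Rightarrow> challenge (H k) p_check i Q \<Theta> \<Theta>') True)"
      by (rule int[of _ 1]) (auto simp: pmf_le_1)
  qed (intro Bochner_Integration.integrable_add Bochner_Integration.integrable_diff
      integrable_mult_right integrable_divide int_g int_coll measure_pmf.integrable_const)
  also have "\<dots> = 1 - p_check * ((\<integral>(k, \<Theta>'). real (G p \<Theta> (tree_diff \<Theta>' \<Theta>)) \<partial>measure_pmf M) / n)
      + (\<integral>x. of_bool (coll x) \<partial>measure_pmf M)"
    using int_g int_coll by simp
  also have "(\<integral>(k, \<Theta>'). real (G p \<Theta> (tree_diff \<Theta>' \<Theta>)) \<partial>measure_pmf M) =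
      measure_pmf.expectation (committed keys \<A> Q) (\<lambda>\<Theta>'. real (G p \<Theta> (tree_diff \<Theta>' \<Theta>)))"
    by (simp add: committed case_prod_unfold)
  also have "(\<integral>x. of_bool (coll x) \<partial>measure_pmf M) = pmf (finds_collision H keys \<A> i Q \<Theta>) True"
    by (simp add: collision pmf_bind indicator_def of_bool_def)
  finally show ?thesis
    by (simp add: n_def)
qed

text \<open>The computational limits of the adversary enter through the bound \<open>negl\<close> on
  its collision probability at each \<kappa>. The first conjunct covers an output fixed in advance,
  the second a random one, with \<open>G\<close> replaced by its mean.\<close>

theorem lemmaE9:
  fixes H :: "nat \<Rightarrow> 'k \<Rightarrow> 'h message \<Rightarrow> 'h"
    and keys :: "nat \<Rightarrow> 'k pmf"
    and \<A> :: "nat \<Rightarrow> 'k adversary"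
    and \<Theta> :: param_tree
    and Q :: "real mat list"
    and p_sketch p_check :: real
    and i :: nat
    and negl :: "nat \<Rightarrow> real"
  assumes "0 < p_sketch" "p_sketch \<le> 1"
    and "0 \<le> p_check" "p_check \<le> 1"
    and "sketch_matrices p_sketch \<Theta> Q"
    and "\<And>\<kappa> \<Theta>'. \<Theta>' \<in> set_pmf (committed (keys \<kappa>) (\<A> \<kappa>) Q) \<Longrightarrow> shape \<Theta>' = shape \<Theta> \<and> \<Theta> \<noteq> \<Theta>'"
    and "negligible_fun negl"
    and "\<And>\<kappa>. pmf (finds_collision (H \<kappa>) (keys \<kappa>) (\<A> \<kappa>) i Q \<Theta>) True \<le> negl \<kappa>"
  shows "\<forall>\<kappa>.
      (\<forall>\<Theta>'. committed (keys \<kappa>) (\<A> \<kappa>) Q = return_pmf \<Theta>' \<longrightarrow>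
         pmf (undetected (H \<kappa>) (keys \<kappa>) (\<A> \<kappa>) p_check i Q \<Theta>) True
           \<le> 1 - p_check * (real (G p_sketch \<Theta> (tree_diff \<Theta>' \<Theta>)) / real (num_params \<Theta>)) + negl \<kappa>)
    \<and> pmf (undetected (H \<kappa>) (keys \<kappa>) (\<A> \<kappa>) p_check i Q \<Theta>) True
        \<le> 1 - p_check * (measure_pmf.expectation (committed (keys \<kappa>) (\<A> \<kappa>) Q)
                (\<lambda>\<Theta>'. real (G p_sketch \<Theta> (tree_diff \<Theta>' \<Theta>))) / real (num_params \<Theta>)) + negl \<kappa>"
proof
  fix \<kappa>
  have bound: "pmf (undetected (H \<kappa>) (keys \<kappa>) (\<A> \<kappa>) p_check i Q \<Theta>) True
      \<le> 1 - p_check * (measure_pmf.expectation (committed (keys \<kappa>) (\<A> \<kappa>) Q)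
            (\<lambda>\<Theta>'. real (G p_sketch \<Theta> (tree_diff \<Theta>' \<Theta>))) / real (num_params \<Theta>)) + negl \<kappa>"
    using pmf_undetected_le[OF assms(3-6)] assms(8) by (rule order_trans[OF _ add_left_mono])
  then show "(\<forall>\<Theta>'. committed (keys \<kappa>) (\<A> \<kappa>) Q = return_pmf \<Theta>' \<longrightarrow>
         pmf (undetected (H \<kappa>) (keys \<kappa>) (\<A> \<kappa>) p_check i Q \<Theta>) True
           \<le> 1 - p_check * (real (G p_sketch \<Theta> (tree_diff \<Theta>' \<Theta>)) / real (num_params \<Theta>)) + negl \<kappa>)
    \<and> pmf (undetected (H \<kappa>) (keys \<kappa>) (\<A> \<kappa>) p_check i Q \<Theta>) True
        \<le> 1 - p_check * (measure_pmf.expectation (committed (keys \<kappa>) (\<A> \<kappa>) Q)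
                (\<lambda>\<Theta>'. real (G p_sketch \<Theta> (tree_diff \<Theta>' \<Theta>))) / real (num_params \<Theta>)) + negl \<kappa>"
    \<comment> \<open>For a point mass the expectation of \<open>G\<close> is its value at the
      single output, so the first conjunct is an instance of \<open>bound\<close>.\<close>
    by auto
qed

end
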